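(* A general elliptic (i.e. smooth) cubic curve in $\mathbb{P}^2$ over $\mathbb{C}$ is the Weddle locus of a suitable linear system of conics of affine dimension $3$ and rank $4$. That is, there is a nonempty Zariski open subset $U$ of the projective space $\mathbb{P}^9$ of plane cubics such that every smooth cubic curve $C\in U$ equals $W(\mathcal{L})$ for some linear system $\mathcal{L}$ of conics in $\mathbb{P}^2$ with $\dim\mathcal{L}=3$ and $\operatorname{rk}\mathcal{L}=4$.
   Context: We work over $\mathbb{C}$, with homogeneous coordinates $[x_0:x_1:x_2]$ on $\mathbb{P}^2$. A linear system $\mathcal{L}$ of conics is (the projectivization of) a linear subspace of the space of quadratic forms in $x_0,x_1,x_2$; its (affine) dimension $\dim\mathcal{L}$ is the dimension of this vector subspace. If $\dim\mathcal{L}=3$ and $Q_0,Q_1,Q_2$ generate $\mathcal{L}$, the Weddle matrix of $\mathcal{L}$ is the $3\times 3$ matrix of linear forms $\mathbf{W}_{\mathcal{L}}=\big[\partial Q_k/\partial x_i\big]_{i,k=0,1,2}$, and the Weddle locus of $\mathcal{L}$ is $W(\mathcal{L})=\{P\in\mathbb{P}^2 : \det\mathbf{W}_{\mathcal{L}}|_P=0\}$. The rank $\operatorname{rk}\mathcal{L}$ is the minimal $r$ such that there are linear forms $l_1,\dots,l_r$ in $x_0,x_1,x_2$ with $\mathcal{L}\subseteq\langle l_1^2,\dots,l_r^2\rangle$ (equivalently, the partially symmetric rank of the associated tensor). *)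

theory Defs
  imports "HOL-Analysis.Analysis" "HOL-Library.Poly_Mapping"
begin

section \<open>Polynomials\<close>

text \<open>
  Complex polynomials in variables indexed by \<^typ>\<open>'v\<close>: finitely supported functions from exponent
  vectors to coefficients, with the ring structure that the library puts on them.
\<close>

type_synonym 'v mpoly = "('v \<Rightarrow>\<^sub>0 nat) \<Rightarrow>\<^sub>0 complex"

definition mscale :: "complex \<Rightarrow> 'v mpoly \<Rightarrow> 'v mpoly" where
  "mscale c p = Poly_Mapping.single 0 c * p"

interpretation mpoly: vector_space mscale
proof
  fix a b :: complex and x y :: "'v mpoly"
  show "mscale a (x + y) = mscale a x + mscale a y"
    by (simp add: mscale_def distrib_left)
  show "mscale (a + b) x = mscale a x + mscale b x"
    by (simp add: mscale_def single_add distrib_right)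
  show "mscale a (mscale b x) = mscale (a * b) x"
    by (simp add: mscale_def mult.assoc [symmetric] mult_single)
  show "mscale 1 x = x"
    by (simp add: mscale_def)
qed

definition mono_degree :: "('v \<Rightarrow>\<^sub>0 nat) \<Rightarrow> nat" where
  "mono_degree m = (\<Sum>v\<in>Poly_Mapping.keys m. Poly_Mapping.lookup m v)"

text \<open>The zero polynomial counts as homogeneous of every degree.\<close>

definition forms :: "nat \<Rightarrow> 'v mpoly set" where
  "forms d = {p. \<forall>m\<in>Poly_Mapping.keys p. mono_degree m = d}"

definition meval :: "'v mpoly \<Rightarrow> ('v \<Rightarrow> complex) \<Rightarrow> complex" where
  "meval p a = (\<Sum>m\<in>Poly_Mapping.keys p. Poly_Mapping.lookup p m *
     (\<Prod>v\<in>Poly_Mapping.keys m. a v ^ Poly_Mapping.lookup m v))"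

text \<open>
  The formal partial derivative. The truncated subtraction of exponents is harmless: a monomial in
  which the variable does not occur gets the coefficient 0.
\<close>

definition pderiv_wrt :: "'v \<Rightarrow> 'v mpoly \<Rightarrow> 'v mpoly" where
  "pderiv_wrt v p = (\<Sum>m\<in>Poly_Mapping.keys p.
     Poly_Mapping.single (m - Poly_Mapping.single v 1)
       (of_nat (Poly_Mapping.lookup m v) * Poly_Mapping.lookup p m))"

section \<open>Projective spaces and the Zariski topology on plane cubics\<close>

text \<open>
  The projectivization of a vector space \<^term>\<open>V\<close> with scalar multiplication \<^term>\<open>scl\<close> is the set of
  its one-dimensional subspaces.
\<close>

definition proj_point :: "(complex \<Rightarrow> 'a \<Rightarrow> 'a) \<Rightarrow> 'a \<Rightarrow> 'a set" where
  "proj_point scl v = range (\<lambda>c. scl c v)"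

definition proj_space :: "(complex \<Rightarrow> 'a \<Rightarrow> 'a) \<Rightarrow> 'a::zero set \<Rightarrow> 'a set set" where
  "proj_space scl V = proj_point scl ` (V - {0})"

abbreviation proj_plane :: "(complex ^ 3) set set" where
  "proj_plane \<equiv> proj_space (*s) UNIV"

abbreviation cubics_space :: "3 mpoly set set" where
  "cubics_space \<equiv> proj_space mscale (forms 3)"

definition zero_locus :: "3 mpoly \<Rightarrow> (complex ^ 3) set set" where
  "zero_locus p = {P \<in> proj_plane. \<forall>x\<in>P. meval p (($) x) = 0}"

text \<open>
  The homogeneous coordinates of a cubic are its coefficients, so the polynomials cutting out a
  closed set of cubics have monomials as variables. The variables belonging to
  monomials of degree other than 3 take the value 0 on every cubic form.
\<close>

definition zariski_closed_cubics :: "3 mpoly set set \<Rightarrow> bool" where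
  "zariski_closed_cubics Z \<longleftrightarrow>
     (\<exists>S :: (3 \<Rightarrow>\<^sub>0 nat) mpoly set. S \<subseteq> (\<Union>e. forms e) \<and>
        Z = {C \<in> cubics_space. \<forall>G\<in>S. \<forall>F\<in>C. meval G (Poly_Mapping.lookup F) = 0})"

definition zariski_open_cubics :: "3 mpoly set set \<Rightarrow> bool" where
  "zariski_open_cubics U \<longleftrightarrow>
     U \<subseteq> cubics_space \<and> zariski_closed_cubics (cubics_space - U)"

definition smooth_cubic :: "3 mpoly \<Rightarrow> bool" where
  "smooth_cubic F \<longleftrightarrow> F \<in> forms 3 \<and> F \<noteq> 0 \<and>
     (\<forall>x :: complex ^ 3. x \<noteq> 0 \<longrightarrow> meval F (($) x) = 0 \<longrightarrow>
        (\<exists>i. meval (pderiv_wrt i F) (($) x) \<noteq> 0))"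

section \<open>Linear systems of conics\<close>

definition conic_system :: "3 mpoly set \<Rightarrow> bool" where
  "conic_system L \<longleftrightarrow> mpoly.subspace L \<and> L \<subseteq> forms 2"

definition system_rank :: "3 mpoly set \<Rightarrow> nat" where
  "system_rank L = (LEAST r. \<exists>l :: nat \<Rightarrow> 3 mpoly.
     (\<forall>i<r. l i \<in> forms 1) \<and> L \<subseteq> mpoly.span ((\<lambda>i. (l i)\<^sup>2) ` {..<r}))"

definition weddle_matrix :: "(3 \<Rightarrow> 3 mpoly) \<Rightarrow> 3 mpoly ^ 3 ^ 3" where
  "weddle_matrix Q = (\<chi> i k. pderiv_wrt i (Q k))"

text \<open>
  Changing the generators multiplies the determinant by the determinant of the base change, so the
  locus can be read off from any choice of generators; see \<open>weddle_locus_eq\<close> below.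
\<close>

definition weddle_locus :: "3 mpoly set \<Rightarrow> (complex ^ 3) set set" where
  "weddle_locus L = {P. \<exists>Q. mpoly.span (range Q) = L \<and> P \<in> zero_locus (det (weddle_matrix Q))}"


lemma meval_superset:
  assumes "finite K" "Poly_Mapping.keys p \<subseteq> K"
  shows "meval p a = (\<Sum>m\<in>K. Poly_Mapping.lookup p m *
     (\<Prod>v\<in>Poly_Mapping.keys m. a v ^ Poly_Mapping.lookup m v))"
  unfolding meval_def
  by (rule sum.mono_neutral_left) (use assms in \<open>auto simp: in_keys_iff\<close>)

lemma meval_add: "meval (p + q) a = meval p a + meval q a"
proof -
  let ?K = "Poly_Mapping.keys p \<union> Poly_Mapping.keys q"
  have "Poly_Mapping.keys (p + q) \<subseteq> ?K" by (rule keys_add)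
  then show ?thesis
    by (simp add: meval_superset [of ?K] lookup_add distrib_right sum.distrib)
qed

lemma meval_0 [simp]: "meval 0 a = 0"
  by (simp add: meval_def)

lemma meval_sum: "meval (sum f I) a = (\<Sum>i\<in>I. meval (f i) a)"
  by (induction I rule: infinite_finite_induct) (auto simp: meval_add)

lemma meval_single:
  "meval (Poly_Mapping.single m c) a =
     c * (\<Prod>v\<in>Poly_Mapping.keys m. a v ^ Poly_Mapping.lookup m v)"
  by (simp add: meval_def)

lemma mono_eval_add:
  fixes a :: "'v \<Rightarrow> complex"
  shows "(\<Prod>v\<in>Poly_Mapping.keys (m + n). a v ^ Poly_Mapping.lookup (m + n) v) =
    (\<Prod>v\<in>Poly_Mapping.keys m. a v ^ Poly_Mapping.lookup m v) *
    (\<Prod>v\<in>Poly_Mapping.keys n. a v ^ Poly_Mapping.lookup n v)"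
proof -
  let ?K = "Poly_Mapping.keys m \<union> Poly_Mapping.keys n"
  have *: "(\<Prod>v\<in>Poly_Mapping.keys k. a v ^ Poly_Mapping.lookup k v) =
      (\<Prod>v\<in>?K. a v ^ Poly_Mapping.lookup k v)" if "Poly_Mapping.keys k \<subseteq> ?K" for k
    by (rule prod.mono_neutral_left) (use that in \<open>auto simp: in_keys_iff\<close>)
  show ?thesis
    unfolding * [OF keys_add] * [OF Un_upper1] * [OF Un_upper2]
    by (simp add: lookup_add power_add prod.distrib)
qed

lemma mpoly_sum_singles:
  fixes p :: "'v mpoly"
  shows "p = (\<Sum>m\<in>Poly_Mapping.keys p. Poly_Mapping.single m (Poly_Mapping.lookup p m))"
  by (rule poly_mapping_eqI) (auto simp: lookup_sum lookup_single when_def in_keys_iff)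

lemma meval_mult: "meval (p * q) a = meval p a * meval q a"
proof -
  have "p * q = (\<Sum>m\<in>Poly_Mapping.keys p. \<Sum>n\<in>Poly_Mapping.keys q.
      Poly_Mapping.single (m + n) (Poly_Mapping.lookup p m * Poly_Mapping.lookup q n))"
    by (subst mpoly_sum_singles [of p], subst mpoly_sum_singles [of q])
      (simp add: sum_product mult_single)
  then show ?thesis
    by (simp add: meval_sum meval_single mono_eval_add)
      (simp add: meval_def sum_product mult_ac)
qed

lemma pderiv_wrt_superset:
  assumes "finite K" "Poly_Mapping.keys p \<subseteq> K"
  shows "pderiv_wrt v p = (\<Sum>m\<in>K.
     Poly_Mapping.single (m - Poly_Mapping.single v 1)
       (of_nat (Poly_Mapping.lookup m v) * Poly_Mapping.lookup p m))"
  unfolding pderiv_wrt_def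
  by (rule sum.mono_neutral_left) (use assms in \<open>auto simp: in_keys_iff\<close>)

lemma pderiv_wrt_add: "pderiv_wrt v (p + q) = pderiv_wrt v p + pderiv_wrt v q"
proof -
  let ?K = "Poly_Mapping.keys p \<union> Poly_Mapping.keys q"
  have "Poly_Mapping.keys (p + q) \<subseteq> ?K" by (rule keys_add)
  then show ?thesis
    by (simp add: pderiv_wrt_superset [of ?K] lookup_add distrib_left single_add sum.distrib)
qed

lemma pderiv_wrt_0 [simp]: "pderiv_wrt v 0 = 0"
  by (simp add: pderiv_wrt_def)

lemma pderiv_wrt_sum: "pderiv_wrt v (sum f I) = (\<Sum>i\<in>I. pderiv_wrt v (f i))"
  by (induction I rule: infinite_finite_induct) (auto simp: pderiv_wrt_add)

lemma lookup_mscale: "Poly_Mapping.lookup (mscale c p) m = c * Poly_Mapping.lookup p m"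
  unfolding mscale_def mult_map_scale_conv_mult [symmetric]
  by (simp add: Poly_Mapping.map.rep_eq when_def)

lemma pderiv_wrt_mscale: "pderiv_wrt v (mscale c p) = mscale c (pderiv_wrt v p)"
proof -
  have "Poly_Mapping.keys (mscale c p) \<subseteq> Poly_Mapping.keys p"
    by (auto simp: in_keys_iff lookup_mscale)
  then have "pderiv_wrt v (mscale c p) = (\<Sum>m\<in>Poly_Mapping.keys p.
     Poly_Mapping.single (m - Poly_Mapping.single v 1)
       (of_nat (Poly_Mapping.lookup m v) * (c * Poly_Mapping.lookup p m)))"
    by (simp add: pderiv_wrt_superset [of "Poly_Mapping.keys p"] lookup_mscale)
  also have "\<dots> = mscale c (pderiv_wrt v p)"
    by (simp add: pderiv_wrt_def mscale_def sum_distrib_left mult_single mult_ac)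
  finally show ?thesis .
qed

lemma zero_locus_weddle_mono:
  assumes "mpoly.span (range Q') \<subseteq> mpoly.span (range Q)"
  shows "zero_locus (det (weddle_matrix Q)) \<subseteq> zero_locus (det (weddle_matrix Q'))"
proof -
  have "\<exists>a. Q' k = (\<Sum>j\<in>UNIV. mscale (a j) (Q j))" for k
  proof -
    have "Q' k \<in> mpoly.span (range Q)"
      using assms mpoly.span_base [of "Q' k" "range Q'"] by blast
    then show ?thesis
    proof (induction rule: mpoly.span_induct_alt)
      case base
      show ?case by (rule exI [of _ "\<lambda>_. 0"]) (simp add: mpoly.scale_zero_left)
    next
      case (step c x y)
      then obtain j a where "x = Q j" "y = (\<Sum>j\<in>UNIV. mscale (a j) (Q j))" by auto
      then have "mscale c x + y = (\<Sum>i\<in>UNIV. mscale (a i + (if i = j then c else 0)) (Q i))"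
        by (simp add: mpoly.scale_left_distrib sum.distrib if_distrib [of "\<lambda>c. mscale c _"]
            mpoly.scale_zero_left sum.delta cong: if_cong)
      then show ?case by (intro exI [of _ "\<lambda>i. a i + (if i = j then c else 0)"])
    qed
  qed
  then obtain A where A: "\<And>k. Q' k = (\<Sum>j\<in>UNIV. mscale (A k j) (Q j))" by metis
  let ?B = "(\<chi> j k. Poly_Mapping.single 0 (A k j)) :: 3 mpoly ^ 3 ^ 3"
  have "weddle_matrix Q' = weddle_matrix Q ** ?B"
    by (simp add: vec_eq_iff weddle_matrix_def matrix_matrix_mult_def A pderiv_wrt_sum
        pderiv_wrt_mscale)
      (simp add: mscale_def mult.commute)
  then show ?thesis
    by (auto simp: zero_locus_def det_mul meval_mult)
qed

lemma weddle_locus_eq: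
  assumes "mpoly.span (range Q) = L"
  shows "weddle_locus L = zero_locus (det (weddle_matrix Q))"
  using zero_locus_weddle_mono assms unfolding weddle_locus_def by blast

end

theory Submission
  imports Defs "HOL-Computational_Algebra.Fundamental_Theorem_Algebra"
begin

text \<open>
  From a point \<open>t\<close> of a smooth cubic at least two lines are tangent to the cubic at points \<open>r\<close>, \<open>s\<close>
  other than \<open>t\<close> (\<open>r\<close> and \<open>s\<close> differ by a 2-torsion point). In the coordinates of the basis \<open>r, t, s\<close> the
  cubic becomes \<open>y\<^sup>2 (x + z) + x z (d x + 2 e y + f z)\<close>, which for every \<open>K\<close> equals
  \<open>z (y\<^sup>2 - K x y + d x\<^sup>2) + x (y\<^sup>2 + (2 e + K) y z + f z\<^sup>2)\<close>. For general \<open>K\<close> the two quadratic forms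
  split into \<open>l\<^sub>1 l\<^sub>2\<close> and \<open>l\<^sub>3 l\<^sub>4\<close>, where \<open>x\<close> is a multiple of \<open>l\<^sub>1 - l\<^sub>2\<close> and \<open>z\<close> of \<open>l\<^sub>3 - l\<^sub>4\<close>. So the
  cubic is a combination of the four products of three of the \<open>l\<^sub>i\<close>, and such a combination is the
  Weddle determinant of a hyperplane of \<open>\<langle>l\<^sub>1\<^sup>2, l\<^sub>2\<^sup>2, l\<^sub>3\<^sup>2, l\<^sub>4\<^sup>2\<rangle>\<close>. Every smooth cubic is reached, so the
  open set can be taken to be the whole space.
\<close>

section \<open>Forms\<close>

lemma meval_uminus: "meval (- p) a = - meval p a"
  by (simp add: meval_def sum_negf)

lemma meval_1 [simp]: "meval 1 a = 1"
  by (simp add: meval_single flip: single_one)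

lemma meval_2 [simp]: "meval 2 a = 2"
  using meval_add [of 1 1 a] by simp

lemma meval_diff: "meval (p - q) a = meval p a - meval q a"
  using meval_add [of p "- q" a] by (simp add: meval_uminus)

lemma meval_mscale: "meval (mscale c p) a = c * meval p a"
  by (simp add: mscale_def meval_mult meval_single)

lemma pderiv_wrt_diff: "pderiv_wrt v (p - q) = pderiv_wrt v p - pderiv_wrt v q"
  by (metis add_diff_cancel_right' diff_add_cancel pderiv_wrt_add)

lemma pderiv_wrt_single:
  "pderiv_wrt v (Poly_Mapping.single m c) =
     Poly_Mapping.single (m - Poly_Mapping.single v 1) (of_nat (Poly_Mapping.lookup m v) * c)"
  by (simp add: pderiv_wrt_def)

lemma pderiv_wrt_mult: "pderiv_wrt v (p * q) = pderiv_wrt v p * q + p * pderiv_wrt v q"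
proof -
  \<comment> \<open>Truncated subtraction commutes with adding \<open>n\<close> when
    \<open>v\<close> occurs in \<open>m\<close>; otherwise both coefficients are 0.\<close>
  have single_shift: "Poly_Mapping.single (m + n - Poly_Mapping.single v 1) (of_nat (Poly_Mapping.lookup m v) * c) =
      Poly_Mapping.single (m - Poly_Mapping.single v 1 + n) (of_nat (Poly_Mapping.lookup m v) * c)"
    for m n and c :: complex
  proof (cases "Poly_Mapping.lookup m v = 0")
    case False
    then have "m + n - Poly_Mapping.single v 1 = m - Poly_Mapping.single v 1 + n"
      by (intro poly_mapping_eqI) (auto simp: lookup_add lookup_minus lookup_single when_def)
    then show ?thesis by simp
  qed simp
  have singles: "pderiv_wrt v (Poly_Mapping.single m a * Poly_Mapping.single n b) =
      pderiv_wrt v (Poly_Mapping.single m a) * Poly_Mapping.single n b +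
      Poly_Mapping.single m a * pderiv_wrt v (Poly_Mapping.single n b)" for m n and a b :: complex
  proof -
    have "pderiv_wrt v (Poly_Mapping.single m a * Poly_Mapping.single n b) =
        Poly_Mapping.single (m + n - Poly_Mapping.single v 1) (of_nat (Poly_Mapping.lookup m v) * (a * b)) +
        Poly_Mapping.single (n + m - Poly_Mapping.single v 1) (of_nat (Poly_Mapping.lookup n v) * (a * b))"
      by (simp add: mult_single pderiv_wrt_single lookup_add distrib_right single_add add.commute)
    then show ?thesis
      by (simp only: single_shift) (simp add: mult_single pderiv_wrt_single ac_simps)
  qed
  let ?p = "\<Sum>m\<in>Poly_Mapping.keys p. Poly_Mapping.single m (Poly_Mapping.lookup p m)"
  let ?q = "\<Sum>m\<in>Poly_Mapping.keys q. Poly_Mapping.single m (Poly_Mapping.lookup q m)"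
  have "pderiv_wrt v (?p * ?q) = pderiv_wrt v ?p * ?q + ?p * pderiv_wrt v ?q"
    by (simp add: sum_product pderiv_wrt_sum singles sum.distrib)
  then show ?thesis
    by (simp flip: mpoly_sum_singles)
qed

section \<open>Degrees of monomials, spaces of forms, linear forms\<close>

lemma mono_degree_add: "mono_degree (m + n) = mono_degree m + mono_degree n"
proof -
  let ?K = "Poly_Mapping.keys m \<union> Poly_Mapping.keys n"
  have *: "mono_degree k = (\<Sum>v\<in>?K. Poly_Mapping.lookup k v)" if "Poly_Mapping.keys k \<subseteq> ?K" for k
    unfolding mono_degree_def
    by (rule sum.mono_neutral_left) (use that in \<open>auto simp: in_keys_iff\<close>)
  show ?thesis
    unfolding * [OF keys_add] * [OF Un_upper1] * [OF Un_upper2]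
    by (simp add: lookup_add sum.distrib)
qed

lemma mono_degree_0_iff [simp]: "mono_degree m = 0 \<longleftrightarrow> m = 0"
  by (auto simp: mono_degree_def in_keys_iff poly_mapping_eq_iff fun_eq_iff)

lemma mono_degree_single [simp]: "mono_degree (Poly_Mapping.single v k) = k"
  by (simp add: mono_degree_def)

lemma mono_degree_SucE:
  assumes "mono_degree m = Suc d"
  obtains v n where "m = Poly_Mapping.single v 1 + n" "mono_degree n = d"
proof -
  from assms obtain v where v: "Poly_Mapping.lookup m v \<noteq> 0"
    using mono_degree_0_iff [of m] by (auto simp: poly_mapping_eq_iff fun_eq_iff)
  have "m = Poly_Mapping.single v 1 + (m - Poly_Mapping.single v 1)"
    using v by (intro poly_mapping_eqI) (auto simp: lookup_add lookup_minus lookup_single when_def)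
  moreover from this assms have "mono_degree (m - Poly_Mapping.single v 1) = d"
    by (metis add_left_cancel mono_degree_add mono_degree_single plus_1_eq_Suc)
  ultimately show ?thesis using that by blast
qed

lemma forms_add: "p \<in> forms d \<Longrightarrow> q \<in> forms d \<Longrightarrow> p + q \<in> forms d"
  using keys_add [of p q] by (auto simp: forms_def)

lemma forms_mscale: "p \<in> forms d \<Longrightarrow> mscale c p \<in> forms d"
  by (auto simp: forms_def in_keys_iff lookup_mscale)

lemma forms_mult: "p \<in> forms d \<Longrightarrow> q \<in> forms e \<Longrightarrow> p * q \<in> forms (d + e)"
  using keys_mult [of p q] by (fastforce simp: forms_def mono_degree_add)

lemma subspace_forms: "mpoly.subspace (forms d)"
  by (auto simp: mpoly.subspace_def forms_add forms_mscale) (simp add: forms_def)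

definition mvar :: "'v \<Rightarrow> 'v mpoly" where
  "mvar v = Poly_Mapping.single (Poly_Mapping.single v 1) 1"

lemma meval_mvar [simp]: "meval (mvar v) a = a v"
  by (simp add: mvar_def meval_single)

lemma pderiv_wrt_mvar [simp]: "pderiv_wrt v (mvar w) = (if v = w then 1 else 0)"
  by (simp add: mvar_def pderiv_wrt_single lookup_single when_def)

lemma mvar_forms: "mvar v \<in> forms 1"
  by (simp add: mvar_def forms_def)

lemma meval_form1_add:
  assumes "l \<in> forms 1"
  shows "meval l (\<lambda>i. a i + b i) = meval l a + meval l b"
proof -
  have "(\<Prod>v\<in>Poly_Mapping.keys m. (a v + b v) ^ Poly_Mapping.lookup m v) =
      (\<Prod>v\<in>Poly_Mapping.keys m. a v ^ Poly_Mapping.lookup m v) +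
      (\<Prod>v\<in>Poly_Mapping.keys m. b v ^ Poly_Mapping.lookup m v)" if m: "m \<in> Poly_Mapping.keys l" for m
  proof -
    have "mono_degree m = Suc 0" using assms m by (simp add: forms_def)
    then obtain v n where "m = Poly_Mapping.single v 1 + n" "mono_degree n = 0"
      by (rule mono_degree_SucE)
    then have "m = Poly_Mapping.single v 1" by simp
    then show ?thesis by simp
  qed
  then show ?thesis
    by (simp add: meval_def distrib_left sum.distrib)
qed

definition linform :: "complex ^ 'v::finite \<Rightarrow> 'v mpoly" where
  "linform w = (\<Sum>v\<in>UNIV. mscale (w $ v) (mvar v))"

lemma linform_forms: "linform w \<in> forms 1"
  unfolding linform_def
  by (intro mpoly.subspace_sum [OF subspace_forms] forms_mscale mvar_forms)

lemma meval_linform: "meval (linform w) a = (\<Sum>v\<in>UNIV. w $ v * a v)"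
  by (simp add: linform_def meval_sum meval_mscale)

lemma pderiv_wrt_linform: "pderiv_wrt v (linform w) = Poly_Mapping.single 0 (w $ v)"
proof -
  have "pderiv_wrt v (linform w) = (\<Sum>u\<in>UNIV. if v = u then Poly_Mapping.single 0 (w $ u) else 0)"
    unfolding linform_def pderiv_wrt_sum pderiv_wrt_mscale
    by (rule sum.cong) (auto simp: mscale_def)
  then show ?thesis by simp
qed

section \<open>Polarization of cubic forms\<close>

locale symmetric_trilinear =
  fixes \<Phi> :: "complex ^ 3 \<Rightarrow> complex ^ 3 \<Rightarrow> complex ^ 3 \<Rightarrow> complex"
  assumes add1: "\<Phi> (a + b) c d = \<Phi> a c d + \<Phi> b c d"
    and scale1: "\<Phi> (k *s a) c d = k * \<Phi> a c d"
    and swap12: "\<Phi> a b c = \<Phi> b a c"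
    and swap23: "\<Phi> a b c = \<Phi> a c b"
begin

lemma add2: "\<Phi> c (a + b) d = \<Phi> c a d + \<Phi> c b d"
  by (metis add1 swap12)

lemma add3: "\<Phi> c d (a + b) = \<Phi> c d a + \<Phi> c d b"
  by (metis add2 swap23)

lemma scale2: "\<Phi> c (k *s a) d = k * \<Phi> c a d"
  by (metis scale1 swap12)

lemma scale3: "\<Phi> c d (k *s a) = k * \<Phi> c d a"
  by (metis scale2 swap23)

lemmas multilinear = add1 add2 add3 scale1 scale2 scale3
lemmas swap = swap12 swap23

end

text \<open>A cubic monomial is a product of three variables, possibly equal. Averaging over the six
  ways to assign the arguments to them gives the polar form.\<close>

lemma polarization_monomial:
  fixes m :: "3 \<Rightarrow>\<^sub>0 nat"
  assumes "mono_degree m = 3"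
  shows "\<exists>\<Phi>. symmetric_trilinear \<Phi> \<and>
    (\<forall>x. \<Phi> x x x = meval (Poly_Mapping.single m c) (($) x)) \<and>
    (\<forall>x i. 3 * \<Phi> x x (axis i 1) = meval (pderiv_wrt i (Poly_Mapping.single m c)) (($) x))"
proof -
  have "mono_degree m = Suc (Suc (Suc 0))" using assms by simp
  then obtain i j k where m: "m = Poly_Mapping.single i 1 + (Poly_Mapping.single j 1 + Poly_Mapping.single k 1)"
    by (elim mono_degree_SucE) auto
  have p: "Poly_Mapping.single m c = mscale c (mvar i * (mvar j * mvar k))"
    by (simp add: m mscale_def mvar_def mult_single)
  define \<Phi> where "\<Phi> x y z = c / 6 * (x $ i * y $ j * z $ k + x $ i * z $ j * y $ k + y $ i * x $ j * z $ k +
     y $ i * z $ j * x $ k + z $ i * x $ j * y $ k + z $ i * y $ j * x $ k)" for x y z :: "complex ^ 3"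
  have "symmetric_trilinear \<Phi>"
    by unfold_locales (simp_all add: \<Phi>_def algebra_simps)
  moreover have "\<Phi> x x x = meval (Poly_Mapping.single m c) (($) x)" for x
    by (simp add: p \<Phi>_def meval_mscale meval_mult)
  moreover have "3 * \<Phi> x x (axis v 1) = meval (pderiv_wrt v (Poly_Mapping.single m c)) (($) x)" for x v
  proof -
    have ev: "meval (if P then 1 else 0) a = (if P then 1 else 0)" for P and a :: "3 \<Rightarrow> complex"
      by (simp add: meval_single flip: single_one)
    show ?thesis
      by (simp add: p \<Phi>_def pderiv_wrt_mscale pderiv_wrt_mult meval_mscale meval_add meval_mult ev axis_def
          algebra_simps)
  qed
  ultimately show ?thesis by blast
qed

text \<open>Polar forms of monomials add up. Since \<open>3 * \<Phi> x x\<close> is the differential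
  of the cubic at \<open>x\<close>, smoothness becomes a condition on \<open>\<Phi>\<close>, and
  changes of basis become multilinear expansions.\<close>

lemma polarization:
  assumes F: "F \<in> forms 3"
  obtains \<Phi> where "symmetric_trilinear \<Phi>" "\<forall>x. \<Phi> x x x = meval F (($) x)"
    "\<forall>x i. 3 * \<Phi> x x (axis i 1) = meval (pderiv_wrt i F) (($) x)"
proof -
  let ?K = "Poly_Mapping.keys F" and ?s = "\<lambda>m. Poly_Mapping.single m (Poly_Mapping.lookup F m)"
  have "\<forall>m\<in>?K. \<exists>\<Phi>. symmetric_trilinear \<Phi> \<and> (\<forall>x. \<Phi> x x x = meval (?s m) (($) x)) \<and>
      (\<forall>x i. 3 * \<Phi> x x (axis i 1) = meval (pderiv_wrt i (?s m)) (($) x))"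
    using F by (auto simp: forms_def intro!: polarization_monomial)
  then obtain \<Psi> where \<Psi>: "\<And>m. m \<in> ?K \<Longrightarrow> symmetric_trilinear (\<Psi> m)"
      "\<And>m x. m \<in> ?K \<Longrightarrow> \<Psi> m x x x = meval (?s m) (($) x)"
      "\<And>m x i. m \<in> ?K \<Longrightarrow> 3 * \<Psi> m x x (axis i 1) = meval (pderiv_wrt i (?s m)) (($) x)"
    by metis
  define \<Phi> where "\<Phi> x y z = (\<Sum>m\<in>?K. \<Psi> m x y z)" for x y z
  have "symmetric_trilinear \<Phi>"
  proof
    show "\<Phi> (a + b) c d = \<Phi> a c d + \<Phi> b c d" for a b c d
      unfolding \<Phi>_def sum.distrib [symmetric]
      by (rule sum.cong) (auto dest: \<Psi>(1) simp: symmetric_trilinear.add1)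
    show "\<Phi> (k *s a) c d = k * \<Phi> a c d" for k a c d
      unfolding \<Phi>_def sum_distrib_left
      by (rule sum.cong) (auto dest: \<Psi>(1) simp: symmetric_trilinear.scale1)
    show "\<Phi> a b c = \<Phi> b a c" for a b c
      unfolding \<Phi>_def by (rule sum.cong) (auto intro: symmetric_trilinear.swap12 \<Psi>(1))
    show "\<Phi> a b c = \<Phi> a c b" for a b c
      unfolding \<Phi>_def by (rule sum.cong) (auto intro: symmetric_trilinear.swap23 \<Psi>(1))
  qed
  moreover have "\<Phi> x x x = meval F (($) x)" for x
    by (subst mpoly_sum_singles [of F]) (simp add: \<Phi>_def meval_sum \<Psi>)
  moreover have "3 * \<Phi> x x (axis i 1) = meval (pderiv_wrt i F) (($) x)" for x i
    by (subst mpoly_sum_singles [of F])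
      (simp add: \<Phi>_def meval_sum pderiv_wrt_sum sum_distrib_left \<Psi>)
  ultimately show ?thesis using that by blast
qed

section \<open>Normal form of a smooth cubic\<close>

lemma dual_basis:
  fixes u v w :: "complex ^ 3"
  assumes indep: "\<And>a b c. a *s u + b *s v + c *s w = 0 \<Longrightarrow> a = 0 \<and> b = 0 \<and> c = 0"
  obtains N :: "complex ^ 3 ^ 3"
  where "\<And>X. X = (N *v X) $ 1 *s u + (N *v X) $ 2 *s v + (N *v X) $ 3 *s w" "det N \<noteq> 0"
proof -
  define M :: "complex ^ 3 ^ 3" where "M = (\<chi> i j. if j = 1 then u $ i else if j = 2 then v $ i else w $ i)"
  have M: "M *v c = c $ 1 *s u + c $ 2 *s v + c $ 3 *s w" for c
    by (simp add: vec_eq_iff M_def matrix_vector_mult_def sum_3 mult.commute)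
  have "\<forall>c. M *v c = 0 \<longrightarrow> c = 0"
  proof (intro allI impI)
    fix c assume "M *v c = 0"
    then have "c $ 1 = 0 \<and> c $ 2 = 0 \<and> c $ 3 = 0"
      using indep unfolding M by blast
    then show "c = 0"
      unfolding vec_eq_iff forall_3 by simp
  qed
  then obtain N where N: "N ** M = mat 1"
    using matrix_left_invertible_ker by blast
  then have "M *v (N *v X) = X" for X
    by (metis matrix_left_right_inverse matrix_vector_mul_assoc matrix_vector_mul_lid)
  moreover have "det N \<noteq> 0"
    using N by (metis det_I det_mul mult_zero_left zero_neq_one)
  ultimately show ?thesis using that M by metis
qed

text \<open>Only constancy is excluded, so lower degrees are covered too; they occur when the base
  point \<open>t\<close> of the tangents is a flex.\<close>

lemma quartic_root:
  fixes c0 c1 c2 c3 c4 :: complex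
  assumes "c1 \<noteq> 0 \<or> c2 \<noteq> 0 \<or> c3 \<noteq> 0 \<or> c4 \<noteq> 0"
  obtains t where "c0 + c1 * t + c2 * t^2 + c3 * t^3 + c4 * t^4 = 0"
proof -
  have "\<not> constant (poly [:c0, c1, c2, c3, c4:])"
    using assms by (auto simp: constant_degree)
  then obtain t where "poly [:c0, c1, c2, c3, c4:] t = 0"
    using fundamental_theorem_of_algebra by blast
  then show ?thesis
    by (intro that [of t]) (simp add: algebra_simps power2_eq_square power3_eq_cube power4_eq_xxxx)
qed

definition independent3 :: "complex ^ 3 \<Rightarrow> complex ^ 3 \<Rightarrow> complex ^ 3 \<Rightarrow> bool" where
  "independent3 u v w \<longleftrightarrow> (\<forall>a b c. a *s u + b *s v + c *s w = 0 \<longrightarrow> a = 0 \<and> b = 0 \<and> c = 0)"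

lemma independent3_spans:
  assumes "independent3 u v w"
  obtains a b c where "X = a *s u + b *s v + c *s w"
proof -
  obtain N :: "complex ^ 3 ^ 3"
    where "\<And>X. X = (N *v X) $ 1 *s u + (N *v X) $ 2 *s v + (N *v X) $ 3 *s w"
    using dual_basis [of u v w] assms unfolding independent3_def by metis
  then show ?thesis using that by blast
qed

lemma independent3_rotate:
  assumes "independent3 u v w"
  shows "independent3 v w u"
  unfolding independent3_def
proof (intro allI impI)
  fix a b c assume "a *s v + b *s w + c *s u = 0"
  then have "c *s u + a *s v + b *s w = 0" by (simp only: ac_simps)
  then show "a = 0 \<and> b = 0 \<and> c = 0" using assms unfolding independent3_def by blast
qed

lemma quadratic_form_root:
  fixes A B C :: complex
  obtains a b where "a \<noteq> 0 \<or> b \<noteq> 0" "A * a^2 + B * a * b + C * b^2 = 0"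
proof (cases "A = 0")
  case True
  then show ?thesis by (intro that [of 1 0]) auto
next
  case False
  then obtain t where "C + B * t + A * t^2 + 0 * t^3 + 0 * t^4 = 0"
    using quartic_root by metis
  then show ?thesis by (intro that [of t 1]) (auto simp: algebra_simps)
qed

section \<open>Points and tangent lines of a smooth cubic\<close>

locale smooth_trilinear = symmetric_trilinear +
  assumes nondegenerate: "x \<noteq> 0 \<Longrightarrow> \<exists>y. \<Phi> x x y \<noteq> 0"
begin

lemma nondegenerate_basis:
  assumes "independent3 u v w" "x \<noteq> 0" "\<Phi> x x u = 0" "\<Phi> x x v = 0"
  shows "\<Phi> x x w \<noteq> 0"
proof
  assume w: "\<Phi> x x w = 0"
  obtain y where y: "\<Phi> x x y \<noteq> 0" using nondegenerate assms by blast
  obtain a b c where "y = a *s u + b *s v + c *s w" using independent3_spans assms by metis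
  with y w assms show False by (simp add: multilinear)
qed

text \<open>Along a line contained in the cubic only the derivative in direction \<open>w\<close>
  can be nonzero. It is a quadratic form on the line, so it has a zero there, which would be a
  singular point.\<close>

lemma contains_no_line:
  assumes indep: "independent3 u v w"
    and zero: "\<Phi> u u u = 0" "\<Phi> u u v = 0" "\<Phi> u v v = 0" "\<Phi> v v v = 0"
  shows False
proof -
  obtain a b where ab: "a \<noteq> 0 \<or> b \<noteq> 0"
    "\<Phi> u u w * a^2 + 2 * \<Phi> u v w * a * b + \<Phi> v v w * b^2 = 0"
    by (rule quadratic_form_root)
  let ?x = "a *s u + b *s v"
  have "?x + 0 *s w \<noteq> 0" using ab(1) indep unfolding independent3_def by blast
  then have "?x \<noteq> 0" by simp
  moreover have "\<Phi> v u v = 0" "\<Phi> v u u = 0" "\<Phi> u v u = 0" "\<Phi> v v u = 0"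
    using zero swap by metis+
  then have "\<Phi> ?x ?x u = 0" "\<Phi> ?x ?x v = 0"
    using zero by (simp_all add: multilinear)
  moreover have "\<Phi> v u w = \<Phi> u v w" by (rule swap12)
  then have "\<Phi> ?x ?x w = 0"
    using ab(2) by (simp add: multilinear algebra_simps power2_eq_square)
  ultimately show False using nondegenerate_basis [OF indep] by blast
qed

lemma point_exists:
  obtains t where "t \<noteq> 0" "\<Phi> t t t = 0"
proof -
  let ?e = "axis 1 1 :: complex ^ 3" and ?f = "axis 2 1 :: complex ^ 3"
  show ?thesis
  proof (cases "\<Phi> ?e ?e ?e = 0")
    case True
    then show ?thesis by (intro that [of ?e]) (auto simp: axis_eq_0_iff)
  next
    case False
    then obtain x where x: "\<Phi> ?f ?f ?f + 3 * \<Phi> ?e ?f ?f * x + 3 * \<Phi> ?e ?e ?f * x^2 + \<Phi> ?e ?e ?e * x^3 + 0 * x^4 = 0"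
      using quartic_root by metis
    let ?t = "?f + x *s ?e"
    have "?t $ 2 = 1" by (simp add: axis_def)
    then have nz: "?t \<noteq> 0" by (metis zero_index zero_neq_one)
    have "\<Phi> ?f ?f ?e = \<Phi> ?e ?f ?f" "\<Phi> ?f ?e ?f = \<Phi> ?e ?f ?f"
      "\<Phi> ?f ?e ?e = \<Phi> ?e ?e ?f" "\<Phi> ?e ?f ?e = \<Phi> ?e ?e ?f"
      by (metis swap)+
    then have "\<Phi> ?t ?t ?t = 0"
      using x by (simp add: multilinear algebra_simps power2_eq_square power3_eq_cube)
    with nz show ?thesis by (rule that)
  qed
qed

text \<open>
  The hypothesis says that the discriminant of the cubic restricted to the line through \<open>t\<close> and \<open>p\<close>
  vanishes, so this line is tangent to the cubic at \<open>p + y t\<close>.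
\<close>

lemma tangent_point:
  assumes "\<Phi> t t t = 0" "\<Phi> t t p = 1" "3 * (\<Phi> t p p)^2 = 4 * \<Phi> p p p"
  obtains y where "\<Phi> t t (p + y *s t) = 1" "\<Phi> (p + y *s t) (p + y *s t) t = 0"
    "\<Phi> (p + y *s t) (p + y *s t) (p + y *s t) = 0"
proof -
  have sw: "\<Phi> p p t = \<Phi> t p p" "\<Phi> p t p = \<Phi> t p p" "\<Phi> p t t = 1" "\<Phi> t p t = 1"
    using assms by (metis swap)+
  \<comment> \<open>The restriction to the line is
    \<open>\<Phi> p p p + 3 * y * \<Phi> t p p + 3 * y^2\<close>; this is its double root.\<close>
  define y where "y = - \<Phi> t p p / 2"
  then have y: "\<Phi> t p p = - 2 * y" "\<Phi> p p p = 3 * y^2"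
    using assms(3) by (auto simp: power2_eq_square)
  show ?thesis
    by (rule that [of y])
      (simp_all add: multilinear sw y assms(1,2) algebra_simps power2_eq_square)
qed

text \<open>The lines through \<open>t\<close> other than the tangent at \<open>t\<close> are
  spanned by \<open>t\<close> and \<open>g + x *s h\<close>, with \<open>h\<close> on that tangent.
  The condition of \<open>tangent_point\<close> is a polynomial of degree at most 4 in
  \<open>x\<close>. One root gives \<open>r\<close>; smoothness at \<open>r\<close> makes it a
  simple root, and another root gives \<open>s\<close>.\<close>

lemma tangent_triangle:
  obtains r t s where "independent3 r t s" "\<Phi> t t t = 0"
    "\<Phi> t t r = 1" "\<Phi> r r t = 0" "\<Phi> r r r = 0"
    "\<Phi> t t s = 1" "\<Phi> s s t = 0" "\<Phi> s s s = 0"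
proof -
  obtain t where t: "t \<noteq> 0" "\<Phi> t t t = 0" by (rule point_exists)
  then obtain g0 where "\<Phi> t t g0 \<noteq> 0" using nondegenerate by blast
  then have "\<Phi> t t ((1 / \<Phi> t t g0) *s g0) = 1" by (simp add: multilinear)
  then obtain g where g: "\<Phi> t t g = 1" by blast
  have "vec.span {g, t} \<noteq> (UNIV :: (complex ^ 3) set)"
  proof
    assume "vec.span {g, t} = UNIV"
    then have "vec.dim (UNIV :: (complex ^ 3) set) \<le> card {g, t}"
      using vec.dim_le_card [of UNIV "{g, t}"] by simp
    also have "\<dots> \<le> 2" by (simp add: card_insert_if)
    finally show False unfolding vec_dim_card by simp
  qed
  then obtain X where X: "X \<notin> vec.span {g, t}" by blast
  define h where "h = X + (- \<Phi> t t X) *s g"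
  have h: "\<Phi> t t h = 0" unfolding h_def multilinear g by simp
  have indep: "independent3 p t h" if p: "\<Phi> t t p = 1" for p
    unfolding independent3_def
  proof (intro allI impI)
    fix a b c assume eq: "a *s p + b *s t + c *s h = 0"
    have "\<Phi> t t (a *s p + b *s t + c *s h) = a" by (simp add: multilinear p t h)
    moreover have "\<Phi> t t 0 = 0" using scale3 [of t t 0 0] by simp
    ultimately have a: "a = 0" using eq by simp
    have c: "c = 0"
    proof (rule ccontr)
      assume "c \<noteq> 0"
      have "X = \<Phi> t t X *s g + (- b / c) *s t"
      proof -
        have "X $ i = \<Phi> t t X * g $ i + (- b / c) * t $ i" for i
        proof -
          have "b * t $ i + c * (X $ i - \<Phi> t t X * g $ i) = 0"
            using arg_cong [OF eq, of "\<lambda>v. v $ i"] a by (simp add: h_def algebra_simps)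
          then have "c * (X $ i - \<Phi> t t X * g $ i) = - (b * t $ i)"
            by (simp add: add_eq_0_iff)
          then have "X $ i - \<Phi> t t X * g $ i = - (b * t $ i) / c"
            using \<open>c \<noteq> 0\<close> by (metis nonzero_mult_div_cancel_left)
          then show ?thesis by (simp add: algebra_simps)
        qed
        then show ?thesis by (simp add: vec_eq_iff)
      qed
      then have "X \<in> vec.span {g, t}"
        by (metis insertCI vec.span_add vec.span_base vec.span_scale)
      with X show False by blast
    qed
    then show "a = 0 \<and> b = 0 \<and> c = 0" using eq a t by simp
  qed
  \<comment> \<open>Otherwise the cubic would contain its tangent at \<open>t\<close>. This keeps
    \<open>?c3\<close> and \<open>?c4\<close> below from vanishing together.\<close>
  have line: "\<Phi> t h h \<noteq> 0 \<or> \<Phi> h h h \<noteq> 0"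
  proof (rule ccontr)
    assume "\<not> ?thesis"
    moreover have "independent3 t h g"
      using indep [OF g] by (rule independent3_rotate)
    ultimately show False using contains_no_line [of t h g] t h by blast
  qed
  have expand2: "\<Phi> t (p + x *s h) (p + x *s h) = \<Phi> t p p + 2 * \<Phi> t p h * x + \<Phi> t h h * x^2" for p x
    using swap23 [of t h p] by (simp add: multilinear algebra_simps power2_eq_square)
  have expand3: "\<Phi> (p + x *s h) (p + x *s h) (p + x *s h) =
      \<Phi> p p p + 3 * \<Phi> p p h * x + 3 * \<Phi> p h h * x^2 + \<Phi> h h h * x^3" for p x
  proof -
    have "\<Phi> h p p = \<Phi> p p h" "\<Phi> p h p = \<Phi> p p h" "\<Phi> h p h = \<Phi> p h h" "\<Phi> h h p = \<Phi> p h h"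
      by (metis swap)+
    then show ?thesis by (simp add: multilinear algebra_simps power2_eq_square power3_eq_cube)
  qed
  let ?c4 = "3 * (\<Phi> t h h)^2" and ?c3 = "\<lambda>p. 12 * \<Phi> t p h * \<Phi> t h h - 4 * \<Phi> h h h"
  have lead: "?c3 p \<noteq> 0 \<or> ?c4 \<noteq> 0" for p using line by auto
  \<comment> \<open>This is \<open>3 * (\<Phi> t p p)^2 - 4 * \<Phi> p p p\<close> at
    \<open>p = g + x *s h\<close>, in powers of \<open>x\<close>.\<close>
  obtain x where x: "(3 * (\<Phi> t g g)^2 - 4 * \<Phi> g g g) + (12 * \<Phi> t g g * \<Phi> t g h - 12 * \<Phi> g g h) * x +
      (12 * (\<Phi> t g h)^2 + 6 * \<Phi> t g g * \<Phi> t h h - 12 * \<Phi> g h h) * x^2 + ?c3 g * x^3 + ?c4 * x^4 = 0"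
    using quartic_root lead by metis
  let ?p = "g + x *s h"
  have "\<Phi> t t ?p = 1" by (simp add: multilinear g h)
  moreover have "3 * (\<Phi> t ?p ?p)^2 = 4 * \<Phi> ?p ?p ?p"
    unfolding expand2 expand3 using x by algebra
  ultimately obtain y where "\<Phi> t t (?p + y *s t) = 1" "\<Phi> (?p + y *s t) (?p + y *s t) t = 0"
    "\<Phi> (?p + y *s t) (?p + y *s t) (?p + y *s t) = 0"
    using tangent_point t by metis
  then obtain r where r: "\<Phi> t t r = 1" "\<Phi> r r t = 0" "\<Phi> r r r = 0" by blast
  have "r \<noteq> 0" using r(1) scale3 [of t t 0 0] by auto
  then have rrh: "\<Phi> r r h \<noteq> 0"
    using nondegenerate_basis [OF indep [OF r(1)]] r by blast
  have trr: "\<Phi> t r r = 0" using r swap by metis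
  \<comment> \<open>With \<open>r\<close> in place of \<open>g\<close> the constant term vanishes,
    and a factor \<open>x\<close> has been divided out. The new constant term is nonzero by
    smoothness at \<open>r\<close>, so the root belongs to a different line through
    \<open>t\<close>.\<close>
  obtain x where x: "- 12 * \<Phi> r r h + (12 * (\<Phi> t r h)^2 - 12 * \<Phi> r h h) * x + ?c3 r * x^2 + ?c4 * x^3 + 0 * x^4 = 0"
    using quartic_root lead by metis
  then have "x \<noteq> 0" using rrh by auto
  let ?p = "r + x *s h"
  have "\<Phi> t t ?p = 1" by (simp add: multilinear r h)
  moreover have "3 * (\<Phi> t ?p ?p)^2 = 4 * \<Phi> ?p ?p ?p"
    unfolding expand2 expand3 trr r(3) using x by algebra
  ultimately obtain y where s: "\<Phi> t t (?p + y *s t) = 1" "\<Phi> (?p + y *s t) (?p + y *s t) t = 0"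
    "\<Phi> (?p + y *s t) (?p + y *s t) (?p + y *s t) = 0"
    using tangent_point t by metis
  have "independent3 r t (?p + y *s t)"
    unfolding independent3_def
  proof (intro allI impI)
    fix a b c assume "a *s r + b *s t + c *s (?p + y *s t) = 0"
    then have "(a + c) *s r + (b + c * y) *s t + (c * x) *s h = 0"
      by (simp add: vec_eq_iff algebra_simps)
    then have "a + c = 0 \<and> b + c * y = 0 \<and> c * x = 0"
      using indep [OF r(1)] unfolding independent3_def by blast
    then show "a = 0 \<and> b = 0 \<and> c = 0" using \<open>x \<noteq> 0\<close> by auto
  qed
  then show ?thesis using that t r s by blast
qed

text \<open>In the basis \<open>r, t, s\<close> the tangency conditions remove \<open>x^3\<close>,
  \<open>y^3\<close>, \<open>z^3\<close>, \<open>x^2 y\<close>, \<open>y z^2\<close> and normalize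
  \<open>x y^2\<close>, \<open>y^2 z\<close>. The coefficients \<open>d = \<Phi> r r s\<close> and
  \<open>f = \<Phi> s s r\<close> are nonzero by smoothness at \<open>r\<close> and
  \<open>s\<close>.\<close>

lemma normal_form:
  obtains N :: "complex ^ 3 ^ 3" and d e f where "det N \<noteq> 0" "d \<noteq> 0" "f \<noteq> 0"
    "\<forall>X x y z. x = (N *v X) $ 1 \<longrightarrow> y = (N *v X) $ 2 \<longrightarrow> z = (N *v X) $ 3 \<longrightarrow>
       \<Phi> X X X = 3 * (y^2 * (x + z) + x * z * (d * x + 2 * e * y + f * z))"
proof -
  obtain r t s where indep: "independent3 r t s" and z: "\<Phi> t t t = 0"
    "\<Phi> t t r = 1" "\<Phi> r r t = 0" "\<Phi> r r r = 0"
    "\<Phi> t t s = 1" "\<Phi> s s t = 0" "\<Phi> s s s = 0"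
    by (rule tangent_triangle)
  obtain N :: "complex ^ 3 ^ 3"
    where N: "\<And>X. X = (N *v X) $ 1 *s r + (N *v X) $ 2 *s t + (N *v X) $ 3 *s s" "det N \<noteq> 0"
    using dual_basis [of r t s] indep unfolding independent3_def by metis
  have "r \<noteq> 0" using z(2) scale3 [of t t 0 0] by auto
  then have d: "\<Phi> r r s \<noteq> 0"
    using nondegenerate_basis [OF indep] z by blast
  have "s \<noteq> 0" using z(5) scale3 [of t t 0 0] by auto
  moreover have "independent3 t s r"
    using indep by (rule independent3_rotate)
  ultimately have f: "\<Phi> s s r \<noteq> 0"
    using nondegenerate_basis [of t s r s] z by blast
  have aab: "\<Phi> u v u = \<Phi> u u v" "\<Phi> v u u = \<Phi> u u v" for u v
    by (metis swap)+
  have rts: "\<Phi> r s t = \<Phi> r t s" "\<Phi> s r t = \<Phi> r t s" "\<Phi> s t r = \<Phi> r t s" "\<Phi> t r s = \<Phi> r t s" "\<Phi> t s r = \<Phi> r t s"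
    by (metis swap)+
  note sw = z aab [of t r] aab [of t s] aab [of r t] aab [of s t] aab [of r s] aab [of s r] rts
  have "\<forall>X x y z. x = (N *v X) $ 1 \<longrightarrow> y = (N *v X) $ 2 \<longrightarrow> z = (N *v X) $ 3 \<longrightarrow>
    \<Phi> X X X = 3 * (y^2 * (x + z) + x * z * (\<Phi> r r s * x + 2 * \<Phi> r t s * y + \<Phi> s s r * z))"
  proof (intro allI impI)
    fix X x y z assume xyz: "x = (N *v X) $ 1" "y = (N *v X) $ 2" "z = (N *v X) $ 3"
    have X: "X = x *s r + y *s t + z *s s" unfolding xyz by (rule N(1))
    show "\<Phi> X X X = 3 * (y^2 * (x + z) + x * z * (\<Phi> r r s * x + 2 * \<Phi> r t s * y + \<Phi> s s r * z))"
      unfolding X by (simp add: multilinear sw algebra_simps power2_eq_square)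
  qed
  with N(2) d f show ?thesis by (rule that)
qed

end

section \<open>Splitting of the two quadratic forms\<close>

lemma quadratic_distinct_roots:
  fixes K d :: complex
  assumes "K \<noteq> 2 * csqrt d" "K \<noteq> - 2 * csqrt d"
  obtains m n where "m + n = K" "m * n = d" "m \<noteq> n"
proof -
  let ?s = "csqrt (K^2 - 4 * d)"
  have "K^2 \<noteq> (2 * csqrt d)^2" using assms power2_eq_iff by fastforce
  then have "?s \<noteq> 0" by (simp add: power_mult_distrib)
  moreover have "(K + ?s) / 2 * ((K - ?s) / 2) = (K^2 - ?s^2) / 4"
    by (simp add: field_simps power2_eq_square)
  ultimately show ?thesis
    by (intro that [of "(K + ?s) / 2" "(K - ?s) / 2"]) (auto simp: field_simps)
qed

text \<open>Take \<open>m, n\<close> as the roots of \<open>T^2 - K T + d\<close> and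
  \<open>\<mu>, \<nu>\<close> as those of \<open>T^2 + (2 e + K) T + f\<close>. Each discriminant
  vanishes for at most two values of \<open>K\<close>, so some \<open>K\<close> avoids all of
  them.\<close>

lemma complete_quadrilateral_parameters:
  fixes d e f :: complex
  obtains m n \<mu> \<nu> where "m * n = d" "\<mu> * \<nu> = f" "m + n + \<mu> + \<nu> = - 2 * e" "m \<noteq> n" "\<mu> \<noteq> \<nu>"
proof -
  have "finite {2 * csqrt d, - 2 * csqrt d, - 2 * e - 2 * csqrt f, - 2 * e + 2 * csqrt f}" by simp
  then obtain K where K: "K \<notin> {2 * csqrt d, - 2 * csqrt d, - 2 * e - 2 * csqrt f, - 2 * e + 2 * csqrt f}"
    using ex_new_if_finite infinite_UNIV_char_0 by blast
  obtain m n where mn: "m + n = K" "m * n = d" "m \<noteq> n"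
    using quadratic_distinct_roots [of K d] K by auto
  obtain \<mu> \<nu> where "\<mu> + \<nu> = - 2 * e - K" "\<mu> * \<nu> = f" "\<mu> \<noteq> \<nu>"
  proof (rule quadratic_distinct_roots)
    show "- 2 * e - K \<noteq> 2 * csqrt f" "- 2 * e - K \<noteq> - 2 * csqrt f"
      using K by (auto simp: algebra_simps)
  qed
  with mn show ?thesis by (intro that [of m n \<mu> \<nu>]) (auto simp: algebra_simps)
qed

section \<open>The linear system of a complete quadrilateral\<close>

lemma span_range:
  fixes Q :: "3 \<Rightarrow> 3 mpoly"
  assumes "inj Q"
  shows "mpoly.span (range Q) = range (\<lambda>c. \<Sum>k\<in>UNIV. mscale (c k) (Q k))"
proof
  show "mpoly.span (range Q) \<subseteq> range (\<lambda>c. \<Sum>k\<in>UNIV. mscale (c k) (Q k))"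
    using assms by (auto simp: mpoly.span_finite sum.reindex)
  show "range (\<lambda>c. \<Sum>k\<in>UNIV. mscale (c k) (Q k)) \<subseteq> mpoly.span (range Q)"
    by (intro image_subsetI, rule mpoly.span_sum, rule mpoly.span_scale, rule mpoly.span_base, rule rangeI)
qed

lemma meval_det3:
  fixes M :: "3 mpoly ^ 3 ^ 3"
  shows "meval (det M) a = det (\<chi> i k. meval (M $ i $ k) a)"
  by (simp add: det_3 meval_add meval_diff meval_mult)

text \<open>
  In the coordinates \<open>(x, y, z) = N X\<close> the sides of the quadrilateral are \<open>y = m x\<close>, \<open>y = n x\<close>,
  \<open>y = \<mu> z\<close> and \<open>y = \<nu> z\<close>. The coefficients of the conics are chosen such that the Jacobian
  determinant becomes a multiple of \<open>z (y - m x) (y - n x) + x (y - \<mu> z) (y - \<nu> z)\<close>.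
\<close>

locale quadrilateral =
  fixes N :: "complex ^ 3 ^ 3" and m n \<mu> \<nu> :: complex
  assumes det: "det N \<noteq> 0" and distinct: "m \<noteq> n" "\<mu> \<noteq> \<nu>"
    and nonzero: "m \<noteq> 0" "n \<noteq> 0" "\<mu> \<noteq> 0" "\<nu> \<noteq> 0"
begin

definition side :: "nat \<Rightarrow> 3 mpoly" where
  "side i = linform (N $ 2 - (if i = 0 then m *s N $ 1 else if i = 1 then n *s N $ 1
     else if i = 2 then \<mu> *s N $ 3 else \<nu> *s N $ 3))"

text \<open>Each square is weighted by the slope of its partner side, so that the derivatives in
  \<open>x\<close> and \<open>z\<close> get common factors \<open>m * n\<close> and
  \<open>\<mu> * \<nu>\<close>. The span consists of the combinations of the squares with
  \<open>a0 / n + a1 / m = a2 / \<nu> + a3 / \<mu>\<close>.\<close>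

definition conic :: "3 \<Rightarrow> 3 mpoly" where
  "conic k = (if k = 1 then mscale n ((side 0)\<^sup>2) + mscale \<mu> ((side 3)\<^sup>2)
     else if k = 2 then mscale m ((side 1)\<^sup>2) + mscale \<mu> ((side 3)\<^sup>2)
     else mscale \<nu> ((side 2)\<^sup>2) - mscale \<mu> ((side 3)\<^sup>2))"

abbreviation "system \<equiv> mpoly.span (range conic)"

lemma meval_side:
  "meval (side 0) (($) X) = (N *v X) $ 2 - m * (N *v X) $ 1"
  "meval (side (Suc 0)) (($) X) = (N *v X) $ 2 - n * (N *v X) $ 1"
  "meval (side 2) (($) X) = (N *v X) $ 2 - \<mu> * (N *v X) $ 3"
  "meval (side 3) (($) X) = (N *v X) $ 2 - \<nu> * (N *v X) $ 3"
  by (simp_all add: side_def meval_linform matrix_vector_mult_def sum_3 algebra_simps)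

lemma side_forms: "side i \<in> forms 1"
  unfolding side_def by (rule linform_forms)

lemma conic_forms: "conic k \<in> forms 2"
proof -
  have "(side i)\<^sup>2 \<in> forms 2" for i
    using forms_mult [OF side_forms side_forms, of i i] by (simp add: power2_eq_square numeral_2_eq_2)
  then show ?thesis
    by (auto simp: conic_def intro!: forms_add forms_mscale mpoly.subspace_diff [OF subspace_forms])
qed

lemma conic_system_system: "conic_system system"
  unfolding conic_system_def
  by (intro conjI mpoly.subspace_span mpoly.span_minimal subspace_forms) (auto simp: conic_forms)

section \<open>Squares in the system, its dimension and its rank\<close>

lemma coordinates_surj: "\<exists>X. N *v X = v"
proof -
  have "invertible N" using det by (simp add: invertible_det_nz)
  then show ?thesis by (metis invertible_right_inverse matrix_vector_mul_assoc matrix_vector_mul_lid)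
qed

text \<open>No side involves both \<open>x\<close> and \<open>z\<close>, so the conics have no term
  in \<open>x z\<close> and the coefficients of \<open>x\<close> and \<open>z\<close> in
  \<open>l\<close> have product 0. The terms in \<open>x y\<close> and \<open>y z\<close> then force
  \<open>c 1 + c 2 = 0\<close>; so at most one coefficient of \<open>l\<close> is nonzero, and the
  pure squares give \<open>c = 0\<close>.\<close>

lemma no_square:
  assumes l: "l \<in> forms 1" and eq: "l\<^sup>2 = (\<Sum>k\<in>UNIV. mscale (c k) (conic k))"
  shows "c k = 0"
proof -
  have "\<forall>v. \<exists>X. N *v X = v" using coordinates_surj by blast
  then obtain r t s where
    r: "(N *v r) $ 1 = 1" "(N *v r) $ 2 = 0" "(N *v r) $ 3 = 0" and
    t: "(N *v t) $ 1 = 0" "(N *v t) $ 2 = 1" "(N *v t) $ 3 = 0" and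
    s: "(N *v s) $ 1 = 0" "(N *v s) $ 2 = 0" "(N *v s) $ 3 = 1"
    by (metis vector_3)
  define \<alpha> \<beta> \<gamma> where "\<alpha> = meval l (($) r)" "\<beta> = meval l (($) t)" "\<gamma> = meval l (($) s)"
  note lin = this
  have add: "meval l (($) (X + Y)) = meval l (($) X) + meval l (($) Y)" for X Y
    using meval_form1_add [OF l, of "($) X" "($) Y"]
    by (simp flip: vector_add_component)
  have "(meval l (($) X))\<^sup>2 = c 1 * (n * (y - m * x)\<^sup>2 + \<mu> * (y - \<nu> * z)\<^sup>2) +
      c 2 * (m * (y - n * x)\<^sup>2 + \<mu> * (y - \<nu> * z)\<^sup>2) + c 3 * (\<nu> * (y - \<mu> * z)\<^sup>2 - \<mu> * (y - \<nu> * z)\<^sup>2)"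
    if "(N *v X) $ 1 = x" "(N *v X) $ 2 = y" "(N *v X) $ 3 = z" for X x y z
    using arg_cong [OF eq, of "\<lambda>p. meval p (($) X)"] that
    by (simp add: sum_3 conic_def power2_eq_square meval_mult meval_add meval_diff meval_mscale meval_side)
  note ev = this
  have a: "\<alpha>\<^sup>2 = m * n * (c 1 * m + c 2 * n)"
    using ev [of r] r by (simp add: lin algebra_simps power2_eq_square)
  have b: "\<beta>\<^sup>2 = c 1 * n + c 2 * m + c 3 * \<nu> + \<mu> * (c 1 + c 2 - c 3)"
    using ev [of t] t by (simp add: lin algebra_simps power2_eq_square)
  have g: "\<gamma>\<^sup>2 = \<mu> * \<nu> * (c 3 * \<mu> + (c 1 + c 2 - c 3) * \<nu>)"
    using ev [of s] s by (simp add: lin algebra_simps power2_eq_square)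
  \<comment> \<open>Values at sums of two basis vectors give the mixed products once the squares are
    subtracted.\<close>
  have "(\<alpha> + \<beta>)\<^sup>2 = c 1 * (n * (1 - m)\<^sup>2 + \<mu>) + c 2 * (m * (1 - n)\<^sup>2 + \<mu>) + c 3 * (\<nu> - \<mu>)"
    using ev [of "r + t"] r t by (simp add: lin add matrix_vector_right_distrib)
  then have ab: "\<alpha> * \<beta> = - m * n * (c 1 + c 2)"
    using a b by algebra
  have "(\<beta> + \<gamma>)\<^sup>2 = c 1 * (n + \<mu> * (1 - \<nu>)\<^sup>2) + c 2 * (m + \<mu> * (1 - \<nu>)\<^sup>2) + c 3 * (\<nu> * (1 - \<mu>)\<^sup>2 - \<mu> * (1 - \<nu>)\<^sup>2)"
    using ev [of "t + s"] s t by (simp add: lin add matrix_vector_right_distrib)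
  then have bg: "\<beta> * \<gamma> = - \<mu> * \<nu> * (c 1 + c 2)"
    using g b by algebra
  have "(\<alpha> + \<gamma>)\<^sup>2 = c 1 * (n * m\<^sup>2 + \<mu> * \<nu>\<^sup>2) + c 2 * (m * n\<^sup>2 + \<mu> * \<nu>\<^sup>2) + c 3 * (\<nu> * \<mu>\<^sup>2 - \<mu> * \<nu>\<^sup>2)"
    using ev [of "r + s"] s r by (simp add: lin add matrix_vector_right_distrib power_mult_distrib)
  then have "\<alpha> * \<gamma> = 0"
    using a g by algebra
  then have c12: "c 1 + c 2 = 0"
    using ab bg nonzero by auto
  then have c2: "c 2 = - c 1" by (simp add: eq_neg_iff_add_eq_0 add.commute)
  have a': "\<alpha>\<^sup>2 = m * n * (m - n) * c 1" and b': "\<beta>\<^sup>2 = (n - m) * c 1 + (\<nu> - \<mu>) * c 3"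
    and g': "\<gamma>\<^sup>2 = \<mu> * \<nu> * (\<mu> - \<nu>) * c 3"
    using a b g by (simp_all add: c2 algebra_simps)
  have "\<alpha> = 0 \<and> \<gamma> = 0 \<or> \<alpha> = 0 \<and> \<beta> = 0 \<or> \<beta> = 0 \<and> \<gamma> = 0"
    using \<open>\<alpha> * \<gamma> = 0\<close> ab bg c12 by auto
  then have "c 1 = 0 \<and> c 3 = 0"
    using a' b' g' nonzero distinct by auto
  then show ?thesis
    using c2 exhaust_3 [of k] by auto
qed

text \<open>The zero polynomial is the square of the linear form 0.\<close>

lemma conic_independent:
  assumes "(\<Sum>k\<in>UNIV. mscale (c k) (conic k)) = 0"
  shows "c k = 0"
  by (rule no_square [of 0]) (use assms in \<open>simp_all add: forms_def\<close>)

lemma inj_conic: "inj conic"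
proof (rule injI, rule ccontr)
  fix j k assume jk: "conic j = conic k" "j \<noteq> k"
  let ?c = "\<lambda>i. (if i = j then 1 else 0) - (if i = k then 1 else 0 :: complex)"
  have "(\<Sum>i\<in>UNIV. mscale (?c i) (conic i)) =
      (\<Sum>i\<in>UNIV. if i = j then conic i else 0) - (\<Sum>i\<in>UNIV. if i = k then conic i else 0)"
    unfolding sum_subtractf [symmetric]
    by (rule sum.cong) (auto simp: mpoly.scale_minus_left)
  also have "\<dots> = 0" using jk by simp
  finally have "?c j = 0" by (rule conic_independent)
  then show False using jk by simp
qed

lemma independent_conics: "mpoly.independent (range conic)"
proof
  assume "mpoly.dependent (range conic)"
  then obtain u j where u: "u (conic j) \<noteq> 0" "(\<Sum>v\<in>range conic. mscale (u v) v) = 0"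
    by (auto simp: mpoly.dependent_finite)
  then have "(\<Sum>k\<in>UNIV. mscale (u (conic k)) (conic k)) = 0"
    by (simp add: sum.reindex inj_conic)
  then show False using conic_independent [of "\<lambda>k. u (conic k)"] u(1) by blast
qed

lemma dim_system: "mpoly.dim system = 3"
  by (simp add: mpoly.dim_eq_card_independent independent_conics card_image inj_conic)

text \<open>
  Three squares that span the system would lie in it, but it contains no square except \<open>0\<close>.
\<close>

lemma system_rank_system: "system_rank system = 4"
  unfolding system_rank_def
proof (rule Least_equality)
  have "(side i)\<^sup>2 \<in> mpoly.span ((\<lambda>i. (side i)\<^sup>2) ` {..<4})" if "i < 4" for i
    using that by (auto intro: mpoly.span_base)
  then have "conic k \<in> mpoly.span ((\<lambda>i. (side i)\<^sup>2) ` {..<4})" for k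
    unfolding conic_def
    by (auto intro!: mpoly.span_add mpoly.span_diff mpoly.span_scale)
  then have "system \<subseteq> mpoly.span ((\<lambda>i. (side i)\<^sup>2) ` {..<4})"
    by (intro mpoly.span_minimal mpoly.subspace_span) auto
  then show "\<exists>l :: nat \<Rightarrow> 3 mpoly. (\<forall>i<4. l i \<in> forms 1) \<and> system \<subseteq> mpoly.span ((\<lambda>i. (l i)\<^sup>2) ` {..<4})"
    by (intro exI [of _ side] conjI allI impI side_forms)
next
  fix r assume "\<exists>l :: nat \<Rightarrow> 3 mpoly. (\<forall>i<r. l i \<in> forms 1) \<and> system \<subseteq> mpoly.span ((\<lambda>i. (l i)\<^sup>2) ` {..<r})"
  then obtain l :: "nat \<Rightarrow> 3 mpoly" where l: "\<And>i. i < r \<Longrightarrow> l i \<in> forms 1"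
    and sub: "system \<subseteq> mpoly.span ((\<lambda>i. (l i)\<^sup>2) ` {..<r})" by blast
  let ?S = "(\<lambda>i. (l i)\<^sup>2) ` {..<r}"
  show "4 \<le> r"
  proof (rule ccontr)
    assume "\<not> 4 \<le> r"
    have "range conic \<subseteq> mpoly.span ?S"
      using sub mpoly.span_superset [of "range conic"] by blast
    \<comment> \<open>The three conics extend to a basis \<open>B\<close> of the span of at most
      three squares; counting shows that nothing was added.\<close>
    then obtain B where B: "range conic \<subseteq> B" "B \<subseteq> mpoly.span ?S" "mpoly.independent B"
        "mpoly.span ?S \<subseteq> mpoly.span B"
      by (rule mpoly.maximal_independent_subset_extend [OF _ independent_conics])
    have fin: "finite B" and card: "card B \<le> card ?S"
      using mpoly.independent_span_bound [OF _ B(3,2)] by auto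
    note card
    also have "card ?S \<le> card {..<r}" by (rule card_image_le) simp
    also have "\<dots> \<le> card (range conic)" using \<open>\<not> 4 \<le> r\<close> by (simp add: card_image inj_conic)
    finally have "range conic = B" using card_seteq [OF fin B(1)] by blast
    then have in_system: "?S \<subseteq> system"
      using B(4) mpoly.span_superset [of ?S] by blast
    have "(l i)\<^sup>2 = 0" if "i < r" for i
    proof -
      have "(l i)\<^sup>2 \<in> system" using in_system that by blast
      then obtain c where c: "(l i)\<^sup>2 = (\<Sum>k\<in>UNIV. mscale (c k) (conic k))"
        by (auto simp: span_range [OF inj_conic])
      then have "c k = 0" for k using no_square l that by blast
      then show ?thesis unfolding c by simp
    qed
    then have "?S \<subseteq> {0}" by auto
    then have "mpoly.span ?S \<subseteq> {0}"
      by (intro mpoly.span_minimal) (auto simp: mpoly.subspace_def)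
    then have "conic 1 = 0" using sub mpoly.span_base [of "conic 1" "range conic"] by blast
    then show False
      using mpoly.dependent_zero [of "range conic"] independent_conics by (metis rangeI)
  qed
qed

text \<open>By the chain rule the Jacobian matrix is \<open>transpose N ** J\<close>, where the rows
  of \<open>J\<close> are the derivatives in \<open>x, y, z\<close> and the columns belong to the
  three conics.\<close>

lemma meval_det_weddle:
  assumes "x = (N *v X) $ 1" "y = (N *v X) $ 2" "z = (N *v X) $ 3"
  shows "meval (det (weddle_matrix conic)) (($) X) =
    8 * det N * (m * n * \<mu> * \<nu> * (m - n) * (\<nu> - \<mu>)) *
      (y\<^sup>2 * (x + z) + x * z * (m * n * x - (m + n + \<mu> + \<nu>) * y + \<mu> * \<nu> * z))"
proof -
  let ?a = "y - m * x" and ?b = "y - n * x" and ?c = "y - \<mu> * z" and ?d = "y - \<nu> * z"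
  define J :: "complex ^ 3 ^ 3" where "J = vector [
    vector [- 2 * m * n * ?a, - 2 * m * n * ?b, 0],
    vector [2 * n * ?a + 2 * \<mu> * ?d, 2 * m * ?b + 2 * \<mu> * ?d, 2 * \<nu> * ?c - 2 * \<mu> * ?d],
    vector [- 2 * \<mu> * \<nu> * ?d, - 2 * \<mu> * \<nu> * ?d, - 2 * \<mu> * \<nu> * ?c + 2 * \<mu> * \<nu> * ?d]]"
  have pderiv_side: "meval (pderiv_wrt i (side j)) a =
      N $ 2 $ i - (if j = 0 then m * N $ 1 $ i else if j = 1 then n * N $ 1 $ i
     else if j = 2 then \<mu> * N $ 3 $ i else \<nu> * N $ 3 $ i)" for i j a
    by (simp add: side_def pderiv_wrt_linform meval_single)
  have "meval (pderiv_wrt i (conic k)) (($) X) = (transpose N ** J) $ i $ k" for i k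
    using exhaust_3 [of k]
    by (auto simp: conic_def power2_eq_square pderiv_wrt_add pderiv_wrt_diff pderiv_wrt_mscale pderiv_wrt_mult
        meval_add meval_diff meval_mscale meval_mult meval_side pderiv_side matrix_matrix_mult_def transpose_def
        sum_3 J_def assms [symmetric] algebra_simps)
  then have "(\<chi> i k. meval (weddle_matrix conic $ i $ k) (($) X)) = transpose N ** J"
    by (simp add: vec_eq_iff weddle_matrix_def)
  then have "meval (det (weddle_matrix conic)) (($) X) = det N * det J"
    by (simp add: meval_det3 det_mul)
  also have "det J = 8 * (m * n * \<mu> * \<nu> * (m - n) * (\<nu> - \<mu>)) *
      (y\<^sup>2 * (x + z) + x * z * (m * n * x - (m + n + \<mu> + \<nu>) * y + \<mu> * \<nu> * z))"
    unfolding det_3 J_def vector_3 by algebra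
  finally show ?thesis by (simp only: ac_simps)
qed

end

section \<open>Every smooth cubic as a Weddle locus\<close>

theorem theorem3p5:
  shows "\<exists>U. zariski_open_cubics U \<and> U \<noteq> {} \<and>
    (\<forall>F :: 3 mpoly. smooth_cubic F \<longrightarrow> proj_point mscale F \<in> U \<longrightarrow>
      (\<exists>L. conic_system L \<and> mpoly.dim L = 3 \<and> system_rank L = 4 \<and>
        zero_locus F = weddle_locus L))"
proof (intro exI [of _ cubics_space] conjI allI impI)
  \<comment> \<open>The constant 1, a form of degree 0, cuts out the empty complement of the whole
    space.\<close>
  have "{C \<in> cubics_space. \<forall>G\<in>{1}. \<forall>F\<in>C. meval G (Poly_Mapping.lookup F) = 0} = {}"
    by (auto simp: proj_space_def proj_point_def)
  moreover have "{1} \<subseteq> (\<Union>e. forms e :: (3 \<Rightarrow>\<^sub>0 nat) mpoly set)"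
    by (auto simp: forms_def intro!: exI [of _ 0])
  ultimately show "zariski_open_cubics cubics_space"
    unfolding zariski_open_cubics_def zariski_closed_cubics_def Diff_cancel
    by (intro conjI subset_refl exI [of _ "{1}"]) simp_all
next
  let ?F = "Poly_Mapping.single (Poly_Mapping.single 1 3) 1 :: 3 mpoly"
  have "?F \<in> forms 3" by (simp add: forms_def)
  moreover have "?F \<noteq> 0" by (metis lookup_single_eq lookup_zero zero_neq_one)
  ultimately show "cubics_space \<noteq> {}" by (auto simp: proj_space_def)
next
  fix F :: "3 mpoly" assume smooth: "smooth_cubic F"
  then have "F \<in> forms 3" by (simp add: smooth_cubic_def)
  then obtain \<Phi> where \<Phi>: "symmetric_trilinear \<Phi>" "\<forall>x. \<Phi> x x x = meval F (($) x)"
    "\<forall>x i. 3 * \<Phi> x x (axis i 1) = meval (pderiv_wrt i F) (($) x)"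
    by (rule polarization)
  interpret symmetric_trilinear \<Phi> by fact
  interpret smooth_trilinear \<Phi>
  proof
    fix x :: "complex ^ 3" assume "x \<noteq> 0"
    show "\<exists>y. \<Phi> x x y \<noteq> 0"
    proof (rule ccontr)
      assume "\<nexists>y. \<Phi> x x y \<noteq> 0"
      then have "meval F (($) x) = 0" "\<And>i. meval (pderiv_wrt i F) (($) x) = 0"
        by (simp_all flip: \<Phi>(2,3) [rule_format])
      then show False using smooth \<open>x \<noteq> 0\<close> unfolding smooth_cubic_def by blast
    qed
  qed
  obtain N :: "complex ^ 3 ^ 3" and d e f where N: "det N \<noteq> 0" "d \<noteq> 0" "f \<noteq> 0"
    and nf: "\<forall>X x y z. x = (N *v X) $ 1 \<longrightarrow> y = (N *v X) $ 2 \<longrightarrow> z = (N *v X) $ 3 \<longrightarrow>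
       \<Phi> X X X = 3 * (y^2 * (x + z) + x * z * (d * x + 2 * e * y + f * z))"
    by (rule normal_form)
  obtain m n \<mu> \<nu> where p: "m * n = d" "\<mu> * \<nu> = f" "m + n + \<mu> + \<nu> = - 2 * e" "m \<noteq> n" "\<mu> \<noteq> \<nu>"
    by (rule complete_quadrilateral_parameters)
  \<comment> \<open>All four slopes are nonzero because their products \<open>d\<close> and
    \<open>f\<close> are.\<close>
  interpret quadrilateral N m n \<mu> \<nu>
    using N p by unfold_locales auto
  \<comment> \<open>By the choice of the slopes both sides are nonzero constants times the same
    normal form.\<close>
  have "meval F (($) X) = 0 \<longleftrightarrow> meval (det (weddle_matrix conic)) (($) X) = 0" for X
    unfolding meval_det_weddle [OF refl refl refl] p \<Phi>(2) [rule_format, symmetric] nf [rule_format, OF refl refl refl]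
    using N p(4,5) nonzero by (simp del: distrib_left_numeral)
  then have "zero_locus F = weddle_locus system"
    unfolding weddle_locus_eq [OF refl] zero_locus_def by (simp only:)
  then show "\<exists>L. conic_system L \<and> mpoly.dim L = 3 \<and> system_rank L = 4 \<and> zero_locus F = weddle_locus L"
    using conic_system_system dim_system system_rank_system by blast
qed

end
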